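(* For every $k\in\mathbb{N}=\{0,1,2,\dots\}$ there is a connected graph $G$ whose Grundy value in the odd/odd vertex removal game satisfies $$g(G)=k.$$
   Context: All graphs are finite, simple and undirected. The odd/odd vertex removal game is the following impartial two-player game. A position is a graph. A move from a graph $G$ consists of choosing a vertex $v$ of odd degree in $G$ and removing $v$ together with all edges incident to it, giving the graph $G-v$. The players alternate moves, both players have the same available moves, and a player who cannot move loses. The Grundy (Sprague-Grundy) value $g(G)$ of a position is defined recursively by $g(G)=\operatorname{mex}\{g(G-v) : v \text{ a vertex of odd degree in } G\}$, where $\operatorname{mex}(A)$ denotes the smallest nonnegative integer not in the set $A$ (so $g(G)=0$ if $G$ has no vertex of odd degree). Connected graphs are nonempty. *)

theory Defs
  imports "Graph_Theory.Graph_Theory"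
begin

text \<open>
  Following the library, a finite simple undirected graph is a symmetric digraph without
  loops and parallel arcs (locale \<^locale>\<open>graph\<close>): each edge is represented by its two
  orientations, so the degree of a vertex is its \<^const>\<open>out_degree\<close>.
\<close>

lemma (in graph) out_degree_eq_card_neighbours:
  "out_degree G v = card {u. v \<rightarrow>\<^bsub>G\<^esub> u}"
proof -
  have "inj_on (head G) (out_arcs G v)"
    by (rule inj_onI) (auto intro!: no_multi_arcs simp: arc_to_ends_def)
  moreover have "head G ` out_arcs G v = {u. v \<rightarrow>\<^bsub>G\<^esub> u}"
    by (auto simp: arcs_ends_def arc_to_ends_def)
  ultimately show ?thesis
    unfolding out_degree_def by (metis card_image)
qed

lemma (in graph) graph_del_vert: "graph (del_vert v)"
proof -
  interpret H: digraph "del_vert v"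
    by unfold_locales
      (auto simp: del_vert_simps arc_to_ends_def no_loops intro: no_multi_arcs)
  have "symmetric (del_vert v)"
    using sym_arcs unfolding symmetric_conv by (fastforce simp: del_vert_simps)
  then show ?thesis by (rule H.graphI)
qed

definition mex :: "nat set \<Rightarrow> nat" where
  "mex A = (LEAST n. n \<notin> A)"

text \<open>
  The test for finiteness only serves to make the recursion well-founded on the whole record
  type; the value on records with infinitely many vertices is irrelevant.
\<close>

function grundy :: "('a, 'b) pre_digraph \<Rightarrow> nat" where
  "grundy G =
    (if finite (verts G)
     then mex ((\<lambda>v. grundy (pre_digraph.del_vert G v)) ` {v \<in> verts G. odd (out_degree G v)})
     else 0)"
  by pat_completeness auto
termination
  by (relation "measure (\<lambda>G. card (verts G))")
    (auto simp: pre_digraph.verts_del_vert intro!: card_Diff1_less simp del: card_Diff_insert card_Diff_singleton)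

declare grundy.simps [simp del]

lemma (in graph) grundy_eq:
  "grundy G = mex {grundy (del_vert v) | v. v \<in> verts G \<and> odd (out_degree G v)}"
  by (subst grundy.simps) (auto intro!: arg_cong[where f = mex])

end

theory Submission
  imports Defs "HOL-Library.Countable" "HOL-Library.Sublist"
begin

text \<open>
  If a graph \<open>H\<close> is attached to a vertex \<open>x\<close> by joining \<open>x\<close> to exactly the odd vertices of
  \<open>H\<close>, then all vertices of \<open>H\<close> become even, and \<open>x\<close> keeps its parity because \<open>H\<close> has evenly
  many odd vertices.  So \<open>H\<close> is frozen until \<open>x\<close> is removed.  Take a complete graph on
  \<open>2k\<close> vertices and attach to each vertex such a graph of value \<open>i < k\<close>, every \<open>i\<close> being
  used twice.  Removing one of the \<open>2k\<close> vertices leaves an odd clique, which is even together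
  with everything hanging below it, and releases the graph of value \<open>i\<close>.  Hence the
  options have exactly the values \<open>0, \<dots>, k - 1\<close>.

  The odd vertices of the new graph are those of the clique, so unfolding this recursion gives
  a rooted tree without its root, in which siblings are adjacent and parents are adjacent to
  their children.
\<close>

lemma mex_lessThan: "mex {..<n} = n"
  unfolding mex_def by (rule Least_equality) auto

text \<open>\<open>to_nat\<close> puts all graphs into one type. With \<open>E\<close> fixed, a move
  is just a deletion from \<open>S\<close>.\<close>

definition coded_graph :: "('a::countable \<Rightarrow> 'a \<Rightarrow> bool) \<Rightarrow> 'a set \<Rightarrow> (nat, nat \<times> nat) pre_digraph" where
  "coded_graph E S =
    \<lparr>verts = to_nat ` S, arcs = {(to_nat u, to_nat w) | u w. u \<in> S \<and> w \<in> S \<and> E u w},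
     tail = fst, head = snd\<rparr>"

lemma verts_coded_graph [simp]: "verts (coded_graph E S) = to_nat ` S"
  by (simp add: coded_graph_def)

lemma arcs_ends_coded_graph:
  "arcs_ends (coded_graph E S) = {(to_nat u, to_nat w) | u w. u \<in> S \<and> w \<in> S \<and> E u w}"
  by (force simp: coded_graph_def arcs_ends_def arc_to_ends_def)

lemma graph_coded_graph:
  assumes "finite S" "symp E" "irreflp E"
  shows "graph (coded_graph E S)"
proof -
  have "arcs (coded_graph E S) \<subseteq> to_nat ` S \<times> to_nat ` S"
    by (auto simp: coded_graph_def)
  then have "finite (arcs (coded_graph E S))"
    by (rule finite_subset) (simp add: assms(1))
  then interpret digraph "coded_graph E S"
    by unfold_locales
      (use assms in \<open>auto simp: coded_graph_def arc_to_ends_def irreflp_def\<close>)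
  have "symmetric (coded_graph E S)"
    unfolding symmetric_def arcs_ends_coded_graph using assms(2)
    by (auto intro!: symI dest: sympD)
  then show ?thesis by (rule graphI)
qed

lemma del_vert_coded_graph:
  "pre_digraph.del_vert (coded_graph E S) (to_nat v) = coded_graph E (S - {v})"
  by (auto simp: coded_graph_def pre_digraph.del_vert_def)

lemma out_degree_coded_graph:
  assumes "u \<in> S"
  shows "out_degree (coded_graph E S) (to_nat u) = card {w \<in> S. E u w}"
proof -
  have "out_arcs (coded_graph E S) (to_nat u) = (\<lambda>w. (to_nat u, to_nat w)) ` {w \<in> S. E u w}"
    using assms by (auto simp: out_arcs_def coded_graph_def)
  then show ?thesis
    by (simp add: out_degree_def card_image inj_on_def)
qed

lemma grundy_coded_graph:
  assumes "finite S"
  shows "grundy (coded_graph E S) =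
    mex ((\<lambda>v. grundy (coded_graph E (S - {v}))) ` {v \<in> S. odd (card {w \<in> S. E v w})})"
proof -
  have "{x \<in> verts (coded_graph E S). odd (out_degree (coded_graph E S) x)} =
      to_nat ` {v \<in> S. odd (card {w \<in> S. E v w})}"
    by (auto simp: out_degree_coded_graph)
  then show ?thesis
    using assms by (subst grundy.simps) (simp add: image_image del_vert_coded_graph)
qed

lemma connected_coded_graphI:
  assumes "finite S" "symp E" "irreflp E" "r \<in> S"
    and reach: "\<And>u. u \<in> S \<Longrightarrow> (\<lambda>x y. x \<in> S \<and> y \<in> S \<and> E x y)\<^sup>*\<^sup>* u r"
  shows "connected (coded_graph E S)"
proof -
  interpret graph "coded_graph E S"
    using assms(1-3) by (rule graph_coded_graph)
  have to_root: "to_nat u \<rightarrow>\<^sup>*\<^bsub>coded_graph E S\<^esub> to_nat r" if "u \<in> S" for u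
    using reach[OF that]
  proof (induction rule: converse_rtranclp_induct)
    case base
    then show ?case using \<open>r \<in> S\<close> by simp
  next
    case (step y z)
    then have "to_nat y \<rightarrow>\<^bsub>coded_graph E S\<^esub> to_nat z"
      by (auto simp: arcs_ends_coded_graph)
    then show ?case using step.IH by (rule adj_reachable_trans)
  qed
  show ?thesis
  proof (intro connectedI reachable_mk_symmetricI)
    show "verts (coded_graph E S) \<noteq> {}"
      using \<open>r \<in> S\<close> by auto
    show "x \<rightarrow>\<^sup>*\<^bsub>coded_graph E S\<^esub> y"
      if "x \<in> verts (coded_graph E S)" "y \<in> verts (coded_graph E S)" for x y
      using that to_root symmetric_reachable' by (auto intro: reachable_trans)
  qed
qed

text \<open>
  A tree node is the list of child indices on the path from the root \<open>[]\<close>, last index first, so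
  that \<^const>\<open>tl\<close> is the parent and ancestors are suffixes.  A node with label \<open>n\<close> has \<open>2n\<close>
  children.
\<close>

fun label :: "nat \<Rightarrow> nat list \<Rightarrow> nat" where
  "label k [] = k"
| "label k (a # p) = a div 2"

fun node :: "nat \<Rightarrow> nat list \<Rightarrow> bool" where
  "node k [] \<longleftrightarrow> True"
| "node k (a # p) \<longleftrightarrow> node k p \<and> a < 2 * label k p"

definition kin :: "nat list \<Rightarrow> nat list \<Rightarrow> bool" where
  "kin u w \<longleftrightarrow> u \<noteq> w \<and> (tl u = tl w \<or> tl u = w \<or> tl w = u)"

text \<open>
  The position after the removal of all ancestors of \<open>v\<close> and \<open>v\<close> itself; every
  position reachable from \<open>remaining k []\<close> is of this form.
\<close>

definition remaining :: "nat \<Rightarrow> nat list \<Rightarrow> nat list set" where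
  "remaining k v = {u. node k u \<and> \<not> suffix u v}"

lemma symp_kin: "symp kin"
  by (auto simp: symp_def kin_def)

lemma irreflp_kin: "irreflp kin"
  by (simp add: irreflp_def kin_def)

text \<open>Since \<open>a < 2 * label k p\<close> gives \<open>a div 2 < label k p\<close>, labels
  drop strictly along a path; this bounds the depth and makes the tree finite.\<close>

lemma node_bounds: "node k u \<Longrightarrow> label k u + length u \<le> k \<and> set u \<subseteq> {..<2 * k}"
proof (induction u)
  case (Cons a p)
  then have "a < 2 * label k p" "label k p + length p \<le> k" "set p \<subseteq> {..<2 * k}"
    by auto
  moreover from this have "a div 2 < label k p" by auto
  ultimately show ?case by auto
qed simp

lemma finite_remaining: "finite (remaining k v)"
proof (rule finite_subset)
  show "remaining k v \<subseteq> {u. set u \<subseteq> {..<2 * k} \<and> length u \<le> k}"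
    unfolding remaining_def using node_bounds by fastforce
qed (simp add: finite_lists_length_le)

lemma node_suffix: "suffix u v \<Longrightarrow> node k v \<Longrightarrow> node k u"
proof -
  have "node k (q @ u) \<Longrightarrow> node k u" for q
    by (induction q) auto
  then show "suffix u v \<Longrightarrow> node k v \<Longrightarrow> node k u"
    by (auto simp: suffix_def)
qed

lemma remaining_Cons: "remaining k v - {m # v} = remaining k (m # v)"
  by (auto simp: remaining_def suffix_Cons)

lemma kin_remaining:
  assumes "a # p \<in> remaining k v"
  shows "{w \<in> remaining k v. kin (a # p) w} =
    (\<lambda>b. b # p) ` {b. b < 2 * label k p \<and> b \<noteq> a \<and> \<not> suffix (b # p) v} \<union>
    (if suffix p v then {} else {p}) \<union>
    (\<lambda>c. c # a # p) ` {..<2 * (a div 2)}" (is "?L = ?R")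
proof (rule set_eqI)
  fix w
  have *: "node k p" "a < 2 * label k p" "\<not> suffix (a # p) v"
    using assms by (auto simp: remaining_def)
  \<comment> \<open>Removed nodes are closed under parents, so a surviving node keeps all its
    children.\<close>
  then have "\<not> suffix (c # a # p) v" for c
    by (meson suffix_ConsD)
  with * show "w \<in> ?L \<longleftrightarrow> w \<in> ?R"
    by (cases w) (auto simp: remaining_def kin_def)
qed

text \<open>
  The children of a node are even in number, so only siblings and the parent matter.  The
  parent and exactly one sibling are gone if the parent is a proper ancestor of \<open>v\<close>, only
  the parent is gone if it is \<open>v\<close> itself, and otherwise neither is.
\<close>

lemma odd_degree_remaining:
  assumes v: "node k v" and u: "u \<in> remaining k v"
  shows "odd (card {w \<in> remaining k v. kin u w}) \<longleftrightarrow> (\<exists>m. u = m # v)"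
proof -
  obtain a p where up: "u = a # p"
    using u by (cases u) (auto simp: remaining_def)
  have a: "a < 2 * label k p" "\<not> suffix (a # p) v"
    using u by (auto simp: up remaining_def)
  define B where "B = {b. b < 2 * label k p \<and> b \<noteq> a \<and> \<not> suffix (b # p) v}"
  have "card {w \<in> remaining k v. kin u w} =
      card ((\<lambda>b. b # p) ` B) + card (if suffix p v then {} else {p}) +
      card ((\<lambda>c. c # a # p) ` {..<2 * (a div 2)})"
    unfolding up kin_remaining[OF u[unfolded up]] B_def[symmetric]
    by (subst card_Un_disjoint; (subst card_Un_disjoint)?) (auto simp: B_def)
  then have card: "card {w \<in> remaining k v. kin u w} =
      card B + (if suffix p v then 0 else 1) + 2 * (a div 2)"
    by (simp add: card_image inj_on_def)
  \<comment> \<open>In the last case \<open>b # p\<close> is the child of \<open>p\<close> on the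
    path to \<open>v\<close>.\<close>
  consider (away) "\<not> suffix p v" | (child) "p = v" | (ancestor) b where "suffix (b # p) v"
    by (metis append_Nil rev_exhaust append.assoc append_Cons suffix_def)
  then show ?thesis
  proof cases
    case away
    then have "B = {..<2 * label k p} - {a}"
      by (auto simp: B_def dest: suffix_ConsD)
    then have "card B = 2 * label k p - 1" using a by simp
    then have "even (card {w \<in> remaining k v. kin u w})"
      unfolding card using away a by simp
    then show ?thesis using away by (auto simp: up)
  next
    case child
    then have "B = {..<2 * label k p} - {a}"
      by (auto simp: B_def dest: suffix_length_le)
    then have "card B = 2 * label k p - 1" using a by simp
    then have "odd (card {w \<in> remaining k v. kin u w})"
      unfolding card using child a by simp
    then show ?thesis using child by (simp add: up)
  next
    case ancestor
    \<comment> \<open>Suffixes of \<open>v\<close> of equal length coincide.\<close>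
    have "c = b" if "suffix (c # p) v" for c
      using suffix_same_cases[OF that ancestor] by (auto simp: suffix_Cons dest: suffix_length_le)
    then have unique: "suffix (c # p) v \<longleftrightarrow> c = b" for c
      using ancestor by blast
    have "b < 2 * label k p"
      using node_suffix[OF ancestor v] by simp
    moreover have "b \<noteq> a" using a ancestor by auto
    moreover have "B = {..<2 * label k p} - {a, b}"
      by (auto simp: B_def unique)
    ultimately have "card B = 2 * label k p - 2" using a by (simp add: card_Diff_subset)
    moreover have "suffix p v" "p \<noteq> v"
      using ancestor by (auto dest: suffix_ConsD suffix_length_le)
    ultimately have "even (card {w \<in> remaining k v. kin u w})" "p \<noteq> v"
      unfolding card by simp_all
    then show ?thesis by (simp add: up)
  qed
qed

text \<open>The moves are the children \<open>m # v\<close>; their labels \<open>m div 2\<close> are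
  smaller and take each value below \<open>label k v\<close>.\<close>

lemma grundy_remaining:
  "node k v \<Longrightarrow> grundy (coded_graph kin (remaining k v)) = label k v"
proof (induction "label k v" arbitrary: v rule: less_induct)
  case less
  have children: "{u \<in> remaining k v. odd (card {w \<in> remaining k v. kin u w})} =
      (\<lambda>m. m # v) ` {..<2 * label k v}"
    (is "?O = ?C")
  proof
    show "?O \<subseteq> ?C"
      using odd_degree_remaining[OF less.prems] by (auto simp: remaining_def)
    have "m # v \<in> remaining k v" if "m < 2 * label k v" for m
      using that less.prems by (auto simp: remaining_def dest: suffix_length_le)
    then show "?C \<subseteq> ?O"
      using odd_degree_remaining[OF less.prems] by auto
  qed
  have "grundy (coded_graph kin (remaining k v)) =
      mex ((\<lambda>m. grundy (coded_graph kin (remaining k (m # v)))) ` {..<2 * label k v})"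
    by (subst grundy_coded_graph[OF finite_remaining])
      (simp add: children image_image remaining_Cons)
  also have "\<dots> = mex ((\<lambda>m. m div 2) ` {..<2 * label k v})"
  proof (intro arg_cong[where f = mex] image_cong refl)
    fix m assume "m \<in> {..<2 * label k v}"
    then have "label k (m # v) < label k v" "node k (m # v)"
      using less.prems by auto
    from less.hyps[OF this] show "grundy (coded_graph kin (remaining k (m # v))) = m div 2"
      by simp
  qed
  also have "(\<lambda>m. m div 2) ` {..<2 * label k v} = {..<label k v}"
  proof
    show "{..<label k v} \<subseteq> (\<lambda>m. m div 2) ` {..<2 * label k v}"
      by (auto intro: image_eqI[where x = "2 * _"])
  qed auto
  finally show ?case by (simp add: mex_lessThan)
qed

text \<open>Going to parents leads to a top-level node, which is \<open>[0]\<close> or its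
  sibling.\<close>

lemma connected_remaining:
  assumes "k > 0"
  shows "connected (coded_graph kin (remaining k []))"
proof (rule connected_coded_graphI)
  let ?R = "\<lambda>x y. x \<in> remaining k [] \<and> y \<in> remaining k [] \<and> kin x y"
  have root: "[0] \<in> remaining k []"
    using assms by (simp add: remaining_def)
  show "?R\<^sup>*\<^sup>* u [0]" if "u \<in> remaining k []" for u
    using that
  proof (induction u)
    case (Cons a p)
    show ?case
    proof (cases "p = []")
      case True
      then show ?thesis
        using Cons.prems root by (cases "a = 0") (auto simp: kin_def)
    next
      case False
      then have p: "p \<in> remaining k []"
        using Cons.prems by (simp add: remaining_def)
      then have "?R (a # p) p"
        using Cons.prems by (simp add: kin_def)
      then show ?thesis
        using Cons.IH[OF p] by (rule converse_rtranclp_into_rtranclp)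
    qed
  qed (simp add: remaining_def)
  show "[0] \<in> remaining k []" by (fact root)
qed (fact finite_remaining symp_kin irreflp_kin)+

theorem theorem7:
  fixes k :: nat
  shows "\<exists>G :: (nat, nat \<times> nat) pre_digraph. graph G \<and> connected G \<and> grundy G = k"
proof (cases "k = 0")
  case True
  \<comment> \<open>For \<open>k = 0\<close> the set \<open>remaining k []\<close> is empty, so its
    graph is not connected; a single vertex serves instead.\<close>
  let ?G = "coded_graph (\<lambda>_ _. False) {()}"
  have "graph ?G" "connected ?G"
    by (auto intro!: graph_coded_graph connected_coded_graphI simp: symp_def irreflp_def)
  moreover have "grundy ?G = 0"
    using mex_lessThan[of 0] by (simp add: grundy_coded_graph)
  ultimately show ?thesis using True by blast
next
  case False
  then show ?thesis
    using graph_coded_graph[OF finite_remaining symp_kin irreflp_kin]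
      connected_remaining grundy_remaining[of k "[]"] by auto
qed

end
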